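(* Let $g\in H(\mathbb{D})$ be such that $T_g$ is a bounded operator from $\mathcal{A}^2$ to $\mathcal{D}$. Then $T_g:\mathcal{A}^2\to\mathcal{D}$ is norm-attaining if and only if $g(z)=az+b$ for some $a,b\in\mathbb{C}$.
   Context: $\mathbb{D}$ is the open unit disc in $\mathbb{C}$ and $H(\mathbb{D})$ is the space of analytic functions on $\mathbb{D}$. For $g\in H(\mathbb{D})$, the operator $T_g$ is defined on $H(\mathbb{D})$ by $T_gf(z)=\int_0^z f(w)g'(w)\,dw$. Let $dA(z)=\frac1\pi\,dx\,dy$. The Bergman space $\mathcal{A}^2$ is the space of all $f\in H(\mathbb{D})$ with $\|f\|_{\mathcal{A}^2}=\big(\int_{\mathbb{D}}|f(z)|^2\,dA(z)\big)^{1/2}<\infty$. The Dirichlet space $\mathcal{D}$ is the space of all $f\in H(\mathbb{D})$ with $\int_{\mathbb{D}}|f'(z)|^2\,dA(z)<\infty$, with norm $\|f\|_{\mathcal{D}}=\big(|f(0)|^2+\int_{\mathbb{D}}|f'(z)|^2\,dA(z)\big)^{1/2}$. A bounded linear operator $T:X\to Y$ between Banach spaces is norm-attaining if there is $x\in X$ with $\|x\|=1$ and $\|Tx\|=\|T\|$, where $\|T\|$ is the operator norm. *)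

theory Defs
  imports "HOL-Complex_Analysis.Complex_Analysis"
begin

text \<open>
  An analytic function on the unit disc is represented by any total function that is
  holomorphic on the disc; its values elsewhere are irrelevant: membership and norms
  in the spaces below, and \<open>T_op g f\<close> on the disc, do not depend on them.
\<close>

abbreviation unit_disc :: "complex set"
  where "unit_disc \<equiv> ball 0 1"

definition analytic_disc :: "(complex \<Rightarrow> complex) set"
  where "analytic_disc = {f. f holomorphic_on unit_disc}"

definition dA :: "complex measure"
  where "dA = density lborel (\<lambda>_. ennreal (1 / pi))"

definition bergman :: "(complex \<Rightarrow> complex) set"
  where "bergman = {f \<in> analytic_disc. set_integrable dA unit_disc (\<lambda>z. (cmod (f z))\<^sup>2)}"

definition bergman_norm :: "(complex \<Rightarrow> complex) \<Rightarrow> real"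
  where "bergman_norm f = sqrt (LINT z:unit_disc|dA. (cmod (f z))\<^sup>2)"

definition dirichlet :: "(complex \<Rightarrow> complex) set"
  where "dirichlet =
    {f \<in> analytic_disc. set_integrable dA unit_disc (\<lambda>z. (cmod (deriv f z))\<^sup>2)}"

definition dirichlet_norm :: "(complex \<Rightarrow> complex) \<Rightarrow> real"
  where "dirichlet_norm f =
    sqrt ((cmod (f 0))\<^sup>2 + (LINT z:unit_disc|dA. (cmod (deriv f z))\<^sup>2))"

definition T_op :: "(complex \<Rightarrow> complex) \<Rightarrow> (complex \<Rightarrow> complex) \<Rightarrow> complex \<Rightarrow> complex"
  where "T_op g f z = contour_integral (linepath 0 z) (\<lambda>w. f w * deriv g w)"

text \<open>
  The following notions concern an operator between spaces given by a carrier and a norm.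
  They are meant for linear operators; \<open>T_op g\<close> is linear on the disc by construction, so
  linearity is not repeated as a condition.
\<close>

definition bounded_op ::
    "'a set \<Rightarrow> ('a \<Rightarrow> real) \<Rightarrow> 'b set \<Rightarrow> ('b \<Rightarrow> real) \<Rightarrow> ('a \<Rightarrow> 'b) \<Rightarrow> bool"
  where "bounded_op X nX Y nY T \<longleftrightarrow>
    (\<forall>x\<in>X. T x \<in> Y) \<and> (\<exists>C. \<forall>x\<in>X. nY (T x) \<le> C * nX x)"

definition op_norm :: "'a set \<Rightarrow> ('a \<Rightarrow> real) \<Rightarrow> ('b \<Rightarrow> real) \<Rightarrow> ('a \<Rightarrow> 'b) \<Rightarrow> real"
  where "op_norm X nX nY T = Sup {nY (T x) |x. x \<in> X \<and> nX x \<le> 1}"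

definition norm_attaining :: "'a set \<Rightarrow> ('a \<Rightarrow> real) \<Rightarrow> ('b \<Rightarrow> real) \<Rightarrow> ('a \<Rightarrow> 'b) \<Rightarrow> bool"
  where "norm_attaining X nX nY T \<longleftrightarrow> (\<exists>x\<in>X. nX x = 1 \<and> nY (T x) = op_norm X nX nY T)"

end

theory Submission
  imports Defs
begin

text \<open>
  Write \<open>h\<close> for the derivative of \<open>g\<close>. Since \<open>T_op g f\<close> vanishes at the origin and has derivative
  \<open>f \<cdot> h\<close> on the disc, its Dirichlet norm is the Bergman norm of \<open>f \<cdot> h\<close>. The question is therefore
  when multiplication by \<open>h\<close> attains its norm \<open>N\<close> on the Bergman space.

  First, \<open>\<bar>h\<bar> \<le> N\<close> on the disc (\<open>multiplier_le_norm\<close>). Iterating the norm inequality from the constant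
  function \<open>1\<close> bounds the norm of \<open>h ^ n\<close> by \<open>N ^ n\<close>; if \<open>\<bar>h\<bar>\<close> exceeded some \<open>r > N\<close> on a nonempty open
  set, which has positive area \<open>m\<close>, then \<open>r ^ (2 * n) * m \<le> N ^ (2 * n)\<close> for all \<open>n\<close>, which is absurd.

  If the norm is attained at \<open>f\<close>, then \<open>\<bar>f\<bar>\<^sup>2 (N\<^sup>2 - \<bar>h\<bar>\<^sup>2)\<close> is a nonnegative continuous function with
  vanishing integral, hence zero. At a point where \<open>f \<noteq> 0\<close> the modulus of \<open>h\<close> equals its upper bound
  \<open>N\<close>, so \<open>h\<close> is constant by the maximum modulus principle, and \<open>g\<close> is affine
  (\<open>multiplier_attaining_imp_constant\<close>). Conversely, if \<open>h\<close> is constant then multiplication by \<open>h\<close>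
  scales every norm by the same factor, and the norm is attained at \<open>1\<close>.
\<close>

section \<open>Normalized area measure\<close>

lemma sets_dA [simp, measurable_cong]: "sets dA = sets borel"
  by (simp add: dA_def)

lemma space_dA [simp]: "space dA = UNIV"
  by (simp add: dA_def)

lemma emeasure_dA: "A \<in> sets borel \<Longrightarrow> emeasure dA A = ennreal (1 / pi) * emeasure lborel A"
  by (simp add: dA_def emeasure_density_const)

lemma measure_dA: "A \<in> sets borel \<Longrightarrow> measure dA A = measure lborel A / pi"
  by (simp add: dA_def measure_density_const)

lemma measure_dA_unit_disc: "measure dA unit_disc = 1"
  by (simp add: measure_dA content_ball unit_ball_vol_2)

lemma emeasure_dA_finite:
  assumes "U \<in> sets borel" "U \<subseteq> unit_disc"
  shows "emeasure dA U < \<infinity>"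
proof -
  have "emeasure dA U \<le> emeasure dA unit_disc"
    using assms by (intro emeasure_mono) auto
  also have "\<dots> < \<infinity>"
    using emeasure_lborel_ball_finite[of "0::complex" 1]
    by (simp add: emeasure_dA ennreal_mult_less_top)
  finally show ?thesis .
qed

lemma measure_dA_open_pos:
  assumes "open U" "U \<subseteq> unit_disc" "U \<noteq> {}"
  shows "0 < measure dA U"
proof -
  obtain z e where e: "0 < e" "ball z e \<subseteq> U"
    using assms by (meson all_not_in_conv openE)
  have "0 < measure dA (ball z e)"
    using e by (simp add: measure_dA)
  also have "\<dots> \<le> measure dA U"
    using e assms emeasure_dA_finite[of U]
    by (intro measure_mono_fmeasurable) (auto simp: fmeasurable_def)
  finally show ?thesis .
qed

text \<open>
  A Chebyshev-type bound. It is applied both to powers of a multiplier, on a set where the multiplier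
  is large, and to a continuous nonnegative function near a point where it is positive.
\<close>

lemma set_integral_ge_on_subset:
  fixes u :: "complex \<Rightarrow> real"
  assumes "U \<in> sets borel" "U \<subseteq> unit_disc" "set_integrable dA unit_disc u"
    and "\<And>z. z \<in> unit_disc \<Longrightarrow> 0 \<le> u z" "\<And>z. z \<in> U \<Longrightarrow> c \<le> u z"
  shows "c * measure dA U \<le> (LINT z:unit_disc|dA. u z)"
proof -
  have "c * measure dA U = (LINT z|dA. c * indicator U z)"
    by simp
  also have "\<dots> \<le> (LINT z|dA. indicator unit_disc z *\<^sub>R u z)"
  proof (rule integral_mono)
    show "integrable dA (\<lambda>z. c * indicator U z)"
      using assms emeasure_dA_finite[of U] by (auto intro!: integrable_real_mult_indicator integrable_mult_right)
    show "integrable dA (\<lambda>z. indicator unit_disc z *\<^sub>R u z)"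
      using assms by (simp add: set_integrable_def)
    show "c * indicator U z \<le> indicator unit_disc z *\<^sub>R u z" for z
      using assms by (auto simp: indicator_def)
  qed
  finally show ?thesis
    by (simp add: set_lebesgue_integral_def)
qed

lemma continuous_nonneg_set_integral_zero:
  fixes u :: "complex \<Rightarrow> real"
  assumes cont: "continuous_on unit_disc u" and int: "set_integrable dA unit_disc u"
    and nonneg: "\<And>z. z \<in> unit_disc \<Longrightarrow> 0 \<le> u z"
    and zero: "(LINT z:unit_disc|dA. u z) = 0" and z: "z \<in> unit_disc"
  shows "u z = 0"
proof (rule ccontr)
  assume "u z \<noteq> 0"
  with nonneg[OF z] have pos: "0 < u z" by simp
  define U where "U = unit_disc \<inter> u -` {u z / 2 <..}"
  have U: "open U"
    unfolding U_def using cont by (intro continuous_open_preimage) auto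
  have "U \<noteq> {}" "U \<subseteq> unit_disc"
    using z pos by (auto simp: U_def)
  then have "0 < u z / 2 * measure dA U"
    using measure_dA_open_pos[OF U] pos by simp
  also have "\<dots> \<le> (LINT z:unit_disc|dA. u z)"
    using U int nonneg by (intro set_integral_ge_on_subset) (auto simp: U_def)
  finally show False
    using zero by simp
qed

section \<open>The Bergman norm\<close>

lemma bergman_norm_nonneg [simp]: "0 \<le> bergman_norm f"
  by (simp add: bergman_norm_def set_lebesgue_integral_def)

lemma bergman_norm_sq: "(bergman_norm f)\<^sup>2 = (LINT z:unit_disc|dA. (cmod (f z))\<^sup>2)"
  by (simp add: bergman_norm_def set_lebesgue_integral_def)

lemma bergman_norm_cong:
  "(\<And>z. z \<in> unit_disc \<Longrightarrow> f z = f' z) \<Longrightarrow> bergman_norm f = bergman_norm f'"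
  unfolding bergman_norm_def
  by (intro arg_cong[where f = sqrt] set_lebesgue_integral_cong) auto

lemma bergman_cmult: "f \<in> bergman \<Longrightarrow> (\<lambda>z. c * f z) \<in> bergman"
  by (auto simp: bergman_def analytic_disc_def norm_mult power_mult_distrib intro!: holomorphic_intros)

lemma bergman_norm_cmult: "bergman_norm (\<lambda>z. c * f z) = cmod c * bergman_norm f"
  by (simp add: bergman_norm_def norm_mult power_mult_distrib real_sqrt_mult)

lemma one_in_bergman: "(\<lambda>_. 1) \<in> bergman"
  using emeasure_dA_finite[of unit_disc]
  by (simp add: bergman_def analytic_disc_def set_integrable_def)

lemma bergman_norm_one: "bergman_norm (\<lambda>_. 1) = 1"
  by (simp add: bergman_norm_def set_lebesgue_integral_def measure_dA_unit_disc)

section \<open>Multiplication operators on the Bergman space\<close>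

text \<open>
  The next two lemmas are the two halves of the argument: a multiplier is bounded pointwise
  by any bound for its operator norm, and one that attains a pointwise bound as a norm is constant. The first uses only
  the continuity of \<open>h\<close>; the second rests on the maximum modulus principle.
\<close>

lemma multiplier_le_norm:
  assumes hol: "h holomorphic_on unit_disc"
    and in_bergman: "\<And>f. f \<in> bergman \<Longrightarrow> (\<lambda>w. f w * h w) \<in> bergman"
    and bound: "\<And>f. f \<in> bergman \<Longrightarrow> bergman_norm (\<lambda>w. f w * h w) \<le> N * bergman_norm f"
    and z: "z \<in> unit_disc"
  shows "cmod (h z) \<le> N"
proof (rule ccontr)
  have N: "0 \<le> N"
    using order_trans[OF bergman_norm_nonneg bound[OF one_in_bergman]]
    by (simp add: bergman_norm_one)
  \<comment> \<open>A level strictly between \<open>N\<close> and \<open>cmod (h z)\<close> makes the geometric growth strict.\<close>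
  assume "\<not> cmod (h z) \<le> N"
  then obtain r where r: "N < r" "r < cmod (h z)"
    using dense by (metis not_le)
  have power: "(\<lambda>w. h w ^ n) \<in> bergman \<and> bergman_norm (\<lambda>w. h w ^ n) \<le> N ^ n" for n
  proof (induction n)
    case 0
    then show ?case by (simp add: one_in_bergman bergman_norm_one)
  next
    case (Suc n)
    have "bergman_norm (\<lambda>w. h w ^ n * h w) \<le> N * bergman_norm (\<lambda>w. h w ^ n)"
      using Suc bound by blast
    also have "\<dots> \<le> N * N ^ n"
      using Suc N by (intro mult_left_mono) auto
    finally show ?case
      using in_bergman[of "\<lambda>w. h w ^ n"] Suc by (simp add: mult.commute)
  qed
  define U where "U = unit_disc \<inter> (\<lambda>w. cmod (h w)) -` {r <..}"
  have U: "open U"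
    unfolding U_def using hol
    by (intro continuous_open_preimage continuous_intros holomorphic_on_imp_continuous_on) auto
  have "z \<in> U" "U \<subseteq> unit_disc"
    using z r by (auto simp: U_def)
  then have m: "0 < measure dA U"
    using measure_dA_open_pos[OF U] by blast
  have ineq: "(r\<^sup>2) ^ n * measure dA U \<le> (N\<^sup>2) ^ n" for n
  proof -
    have "(r ^ n)\<^sup>2 * measure dA U \<le> (LINT w:unit_disc|dA. (cmod (h w ^ n))\<^sup>2)"
    proof (rule set_integral_ge_on_subset)
      show "set_integrable dA unit_disc (\<lambda>w. (cmod (h w ^ n))\<^sup>2)"
        using power[of n] by (simp add: bergman_def)
      show "(r ^ n)\<^sup>2 \<le> (cmod (h w ^ n))\<^sup>2" if "w \<in> U" for w
        using that r N by (auto simp: U_def norm_power intro!: power_mono)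
    qed (use U in \<open>auto simp: U_def\<close>)
    also have "\<dots> = (bergman_norm (\<lambda>w. h w ^ n))\<^sup>2"
      by (simp add: bergman_norm_sq)
    also have "\<dots> \<le> (N ^ n)\<^sup>2"
      using power[of n] by (intro power_mono) auto
    finally show ?thesis
      by (simp add: power_mult[symmetric] mult.commute)
  qed
  have rpos: "0 < r\<^sup>2" and "N\<^sup>2 / r\<^sup>2 < 1"
    using N r by (auto simp: power_strict_mono)
  then obtain n where "(N\<^sup>2 / r\<^sup>2) ^ n < measure dA U"
    using real_arch_pow_inv[OF m] by blast
  then have "(N\<^sup>2) ^ n < measure dA U * (r\<^sup>2) ^ n"
    using rpos by (simp add: power_divide pos_divide_less_eq)
  with ineq[of n] show False
    by (simp add: mult.commute)
qed

lemma multiplier_attaining_imp_constant: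
  assumes hol: "h holomorphic_on unit_disc"
    and le: "\<And>z. z \<in> unit_disc \<Longrightarrow> cmod (h z) \<le> N"
    and f: "f \<in> bergman" "bergman_norm f \<noteq> 0"
    and fh: "(\<lambda>w. f w * h w) \<in> bergman" "bergman_norm (\<lambda>w. f w * h w) = N * bergman_norm f"
  shows "h constant_on unit_disc"
proof -
  \<comment> \<open>Attainment says that this nonnegative function integrates to \<open>0\<close>.\<close>
  define u where "u z = N\<^sup>2 * (cmod (f z))\<^sup>2 - (cmod (f z * h z))\<^sup>2" for z
  have u: "u z = (N\<^sup>2 - (cmod (h z))\<^sup>2) * (cmod (f z))\<^sup>2" for z
    by (simp add: u_def norm_mult power_mult_distrib algebra_simps)
  have holf: "f holomorphic_on unit_disc"
    using f by (simp add: bergman_def analytic_disc_def)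
  have u_zero: "u z = 0" if "z \<in> unit_disc" for z
  proof (rule continuous_nonneg_set_integral_zero[OF _ _ _ _ that])
    show "continuous_on unit_disc u"
      unfolding u_def using hol holf
      by (intro continuous_intros holomorphic_on_imp_continuous_on)
    have int: "set_integrable dA unit_disc (\<lambda>z. N\<^sup>2 * (cmod (f z))\<^sup>2)"
      "set_integrable dA unit_disc (\<lambda>z. (cmod (f z * h z))\<^sup>2)"
      using f fh by (auto simp: bergman_def)
    show "set_integrable dA unit_disc u"
      unfolding u_def using int by (rule set_integral_diff)
    have "(LINT z:unit_disc|dA. u z) =
        N\<^sup>2 * (bergman_norm f)\<^sup>2 - (bergman_norm (\<lambda>w. f w * h w))\<^sup>2"
      unfolding u_def using int by (simp add: set_integral_diff bergman_norm_sq)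
    then show "(LINT z:unit_disc|dA. u z) = 0"
      by (simp add: fh power_mult_distrib)
    show "0 \<le> u z" if "z \<in> unit_disc" for z
      unfolding u using le[OF that] by (simp add: power_mono)
  qed
  obtain \<xi> where \<xi>: "\<xi> \<in> unit_disc" "f \<xi> \<noteq> 0"
  proof (rule ccontr)
    \<comment> \<open>Writing the zero function as a multiple of \<open>1\<close> lets homogeneity compute its norm.\<close>
    assume "\<not> thesis"
    with that have "bergman_norm f = bergman_norm (\<lambda>z. 0 * 1)"
      by (intro bergman_norm_cong) auto
    with f show False
      by (simp only: bergman_norm_cmult) simp
  qed
  have "(cmod (h \<xi>))\<^sup>2 = N\<^sup>2"
    using u_zero[OF \<xi>(1)] \<xi>(2) by (simp add: u)
  moreover have "0 \<le> N"
    using le[OF \<xi>(1)] norm_ge_zero order_trans by blast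
  ultimately have "cmod (h \<xi>) = N"
    by (metis norm_ge_zero power2_eq_imp_eq)
  with le have "cmod (h z) \<le> cmod (h \<xi>)" if "z \<in> unit_disc" for z
    using that by simp
  then show ?thesis
    using \<xi>(1) by (intro maximum_modulus_principle[OF hol _ _ _ _ \<xi>(1)]) auto
qed

section \<open>The Volterra operator as a multiplication operator\<close>

lemma T_op_has_field_derivative:
  assumes "g \<in> analytic_disc" "f \<in> analytic_disc" "z \<in> unit_disc"
  shows "(T_op g f has_field_derivative f z * deriv g z) (at z)"
proof -
  have "(\<lambda>w. f w * deriv g w) holomorphic_on unit_disc"
    using assms by (auto simp: analytic_disc_def intro!: holomorphic_intros holomorphic_deriv)
  then obtain F where F: "\<And>w. w \<in> unit_disc \<Longrightarrow>
      (F has_field_derivative f w * deriv g w) (at w within unit_disc)"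
    using holomorphic_convex_primitive'[of unit_disc] by auto
  have eq: "T_op g f w = F w - F 0" if "w \<in> unit_disc" for w
  proof -
    have "path_image (linepath 0 w) \<subseteq> unit_disc"
      using that by (simp add: path_image_linepath closed_segment_subset)
    then have "((\<lambda>w. f w * deriv g w) has_contour_integral (F w - F 0)) (linepath 0 w)"
      using contour_integral_primitive[OF F valid_path_linepath] by fastforce
    then show ?thesis
      by (simp add: T_op_def contour_integral_unique)
  qed
  have "(F has_field_derivative f z * deriv g z) (at z)"
    using F[OF assms(3)] assms(3) by (simp add: at_within_open[OF _ open_ball])
  then have "((\<lambda>w. F w - F 0) has_field_derivative f z * deriv g z) (at z)"
    by (auto intro!: derivative_eq_intros)
  then show ?thesis
    by (rule has_field_derivative_transform_within_open[OF _ open_ball assms(3)])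
      (simp add: eq)
qed

lemma deriv_T_op:
  assumes "g \<in> analytic_disc" "f \<in> bergman" "z \<in> unit_disc"
  shows "deriv (T_op g f) z = f z * deriv g z"
  using T_op_has_field_derivative[of g f z] assms
  by (auto simp: bergman_def intro!: DERIV_imp_deriv)

lemma mult_deriv_in_bergman:
  assumes "g \<in> analytic_disc" "f \<in> bergman" "T_op g f \<in> dirichlet"
  shows "(\<lambda>w. f w * deriv g w) \<in> bergman"
proof -
  have "set_integrable dA unit_disc (\<lambda>z. (cmod (deriv (T_op g f) z))\<^sup>2)"
    using assms by (simp add: dirichlet_def)
  then have "set_integrable dA unit_disc (\<lambda>z. (cmod (f z * deriv g z))\<^sup>2)"
    using deriv_T_op[OF assms(1,2)] by (subst set_integrable_cong) auto
  then show ?thesis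
    using assms(1,2)
    by (auto simp: bergman_def analytic_disc_def intro!: holomorphic_intros holomorphic_deriv)
qed

lemma dirichlet_norm_T_op:
  assumes "g \<in> analytic_disc" "f \<in> bergman"
  shows "dirichlet_norm (T_op g f) = bergman_norm (\<lambda>w. f w * deriv g w)"
proof -
  have "dirichlet_norm (T_op g f) = bergman_norm (deriv (T_op g f))"
    by (simp add: dirichlet_norm_def bergman_norm_def T_op_def)
  also have "\<dots> = bergman_norm (\<lambda>w. f w * deriv g w)"
    using deriv_T_op[OF assms] by (rule bergman_norm_cong)
  finally show ?thesis .
qed

text \<open>
  The operator norm is a supremum over the unit ball, so boundedness is needed to know that it is an
  upper bound; rescaling extends the estimate from the unit ball to the whole space.
\<close>

lemma dirichlet_norm_T_op_le_op_norm:
  assumes g: "g \<in> analytic_disc"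
    and bdd: "bounded_op bergman bergman_norm dirichlet dirichlet_norm (T_op g)"
    and f: "f \<in> bergman"
  shows "dirichlet_norm (T_op g f) \<le>
    op_norm bergman bergman_norm dirichlet_norm (T_op g) * bergman_norm f"
proof -
  obtain C where C: "\<And>f. f \<in> bergman \<Longrightarrow> dirichlet_norm (T_op g f) \<le> C * bergman_norm f"
    using bdd by (auto simp: bounded_op_def)
  let ?S = "{dirichlet_norm (T_op g x) |x. x \<in> bergman \<and> bergman_norm x \<le> 1}"
  have "bdd_above ?S"
  proof (rule bdd_aboveI)
    fix y assume "y \<in> ?S"
    then obtain x where x: "y = dirichlet_norm (T_op g x)" "x \<in> bergman" "bergman_norm x \<le> 1"
      by auto
    have "y \<le> C * bergman_norm x"
      using C x by simp
    also have "\<dots> \<le> \<bar>C\<bar> * bergman_norm x"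
      by (intro mult_right_mono) auto
    also have "\<dots> \<le> \<bar>C\<bar>"
      using x by (simp add: mult_left_le)
    finally show "y \<le> \<bar>C\<bar>" .
  qed
  then have upper: "dirichlet_norm (T_op g x) \<le> op_norm bergman bergman_norm dirichlet_norm (T_op g)"
    if "x \<in> bergman" "bergman_norm x \<le> 1" for x
    unfolding op_norm_def using that by (intro cSup_upper) auto
  show ?thesis
  proof (cases "bergman_norm f = 0")
    case True
    then show ?thesis using C[OF f] by simp
  next
    case False
    then have pos: "0 < bergman_norm f"
      by (simp add: less_le)
    define c where "c = complex_of_real (1 / bergman_norm f)"
    have c: "cmod c = 1 / bergman_norm f"
      unfolding c_def norm_of_real using pos by simp
    have cf: "(\<lambda>z. c * f z) \<in> bergman"
      using f by (rule bergman_cmult)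
    have "dirichlet_norm (T_op g (\<lambda>z. c * f z)) = cmod c * dirichlet_norm (T_op g f)"
      using bergman_norm_cmult[of c "\<lambda>w. f w * deriv g w"]
      by (simp add: dirichlet_norm_T_op g f cf mult.assoc)
    moreover have "bergman_norm (\<lambda>z. c * f z) \<le> 1"
      using pos by (simp add: bergman_norm_cmult c)
    ultimately show ?thesis
      using upper[OF cf] pos by (simp add: c pos_divide_le_eq)
  qed
qed

lemma deriv_constant_on_disc_iff_affine:
  assumes "g \<in> analytic_disc"
  shows "deriv g constant_on unit_disc \<longleftrightarrow> (\<exists>a b. \<forall>z\<in>unit_disc. g z = a * z + b)"
proof
  assume "deriv g constant_on unit_disc"
  then obtain a where a: "\<And>z. z \<in> unit_disc \<Longrightarrow> deriv g z = a"
    by (auto simp: constant_on_def)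
  have "((\<lambda>z. g z - a * z) has_field_derivative 0) (at z within unit_disc)"
    if "z \<in> unit_disc" for z
  proof -
    have "(g has_field_derivative a) (at z)"
      using holomorphic_derivI[OF _ open_ball that] assms a[OF that]
      by (auto simp: analytic_disc_def)
    then have "((\<lambda>z. g z - a * z) has_field_derivative 0) (at z)"
      by (auto intro!: derivative_eq_intros)
    then show ?thesis
      by (rule has_field_derivative_at_within)
  qed
  then obtain b where "\<forall>z\<in>unit_disc. g z - a * z = b"
    using has_field_derivative_zero_constant[OF convex_ball] by blast
  then have "\<forall>z\<in>unit_disc. g z = a * z + b"
    by (metis add.commute diff_add_cancel)
  then show "\<exists>a b. \<forall>z\<in>unit_disc. g z = a * z + b"
    by blast
next
  assume "\<exists>a b. \<forall>z\<in>unit_disc. g z = a * z + b"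
  then obtain a b where ab: "\<And>z. z \<in> unit_disc \<Longrightarrow> g z = a * z + b"
    by blast
  have "deriv g z = a" if "z \<in> unit_disc" for z
  proof (rule DERIV_imp_deriv)
    have "((\<lambda>z. a * z + b) has_field_derivative a) (at z)"
      by (auto intro!: derivative_eq_intros)
    then show "(g has_field_derivative a) (at z)"
      by (rule has_field_derivative_transform_within_open[OF _ open_ball that]) (simp add: ab)
  qed
  then show "deriv g constant_on unit_disc"
    by (auto simp: constant_on_def)
qed

theorem theorem4:
  fixes g :: "complex \<Rightarrow> complex"
  assumes "g \<in> analytic_disc"
    and "bounded_op bergman bergman_norm dirichlet dirichlet_norm (T_op g)"
  shows "norm_attaining bergman bergman_norm dirichlet_norm (T_op g) \<longleftrightarrow>
    (\<exists>a b. \<forall>z\<in>unit_disc. g z = a * z + b)"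
proof -
  let ?h = "deriv g"
  let ?N = "op_norm bergman bergman_norm dirichlet_norm (T_op g)"
  have hol: "?h holomorphic_on unit_disc"
    using assms(1) by (auto simp: analytic_disc_def intro!: holomorphic_deriv)
  have fh: "(\<lambda>w. f w * ?h w) \<in> bergman" if "f \<in> bergman" for f
    using that assms by (intro mult_deriv_in_bergman) (auto simp: bounded_op_def)
  note norm_eq = dirichlet_norm_T_op[OF assms(1)]
  have "norm_attaining bergman bergman_norm dirichlet_norm (T_op g) \<longleftrightarrow> ?h constant_on unit_disc"
  proof
    assume "norm_attaining bergman bergman_norm dirichlet_norm (T_op g)"
    then obtain f where f: "f \<in> bergman" "bergman_norm f = 1" "dirichlet_norm (T_op g f) = ?N"
      by (auto simp: norm_attaining_def)
    have "cmod (?h z) \<le> ?N" if "z \<in> unit_disc" for z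
      using multiplier_le_norm[OF hol fh _ that, of ?N]
        dirichlet_norm_T_op_le_op_norm[OF assms] norm_eq by simp
    then show "?h constant_on unit_disc"
      using f norm_eq fh by (intro multiplier_attaining_imp_constant[OF hol, of ?N f]) auto
  next
    assume "?h constant_on unit_disc"
    then obtain a where a: "\<And>z. z \<in> unit_disc \<Longrightarrow> ?h z = a"
      by (auto simp: constant_on_def)
    have scale: "dirichlet_norm (T_op g f) = cmod a * bergman_norm f" if "f \<in> bergman" for f
    proof -
      have "dirichlet_norm (T_op g f) = bergman_norm (\<lambda>w. a * f w)"
        unfolding norm_eq[OF that] by (rule bergman_norm_cong) (simp add: a)
      then show ?thesis
        by (simp add: bergman_norm_cmult)
    qed
    \<comment> \<open>The supremum is a maximum, taken at the constant function \<open>1\<close>, which has norm \<open>1\<close>.\<close>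
    have "?N = cmod a"
      unfolding op_norm_def
    proof (rule cSup_eq_maximum)
      show "cmod a \<in> {dirichlet_norm (T_op g x) |x. x \<in> bergman \<and> bergman_norm x \<le> 1}"
        using scale[OF one_in_bergman] one_in_bergman by (force simp: bergman_norm_one)
      show "y \<le> cmod a"
        if "y \<in> {dirichlet_norm (T_op g x) |x. x \<in> bergman \<and> bergman_norm x \<le> 1}" for y
        using that by (auto simp: scale mult_left_le)
    qed
    then show "norm_attaining bergman bergman_norm dirichlet_norm (T_op g)"
      unfolding norm_attaining_def
      using scale[OF one_in_bergman] one_in_bergman bergman_norm_one by (intro bexI) auto
  qed
  with deriv_constant_on_disc_iff_affine[OF assms(1)] show ?thesis
    by simp
qed

end
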